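(* Let $\alpha_k=(-1)^{\lfloor(4k+1)/3\rfloor}q^{k(k-2)/3}(1+q+\cdots+q^{2k})$ if $k\not\equiv1\pmod 3$ and $\alpha_k=0$ if $k\equiv1\pmod3$. Then for every integer $p\ge1$, every positive integer $N$ and every primitive $N$th root of unity $q$, $$H_p^{(1)}(q)=-q^{-1}(1-q)\sum_{k=0}^{N-1}(-1)^kq^{\binom{k+1}{2}+(p-1)(k^2+k)}\alpha_k.$$
   Context: $(a)_n=\prod_{k=1}^n(1-aq^{k-1})$, $\begin{bmatrix} n\\ k\end{bmatrix}=\frac{(q)_n}{(q)_{n-k}(q)_k}$. $H_p^{(1)}(q)=\sum_{n_p\ge\cdots\ge n_1\ge0}q^{n_p}(q^{n_p+1})_{n_p+1}\prod_{i=1}^{p-1}q^{n_i(n_i+1)}\begin{bmatrix} n_{i+1}\\ n_i\end{bmatrix}$; at a root of unity only finitely many terms are nonzero. (The factor $1+q+\cdots+q^{2k}$ is $\frac{1-q^{2k+1}}{1-q}$.) *)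

theory Defs
  imports "HOL-Analysis.Analysis" "HOL-Computational_Algebra.Polynomial"
begin

definition primitive_unity_root :: "nat \<Rightarrow> complex \<Rightarrow> bool" where
  "primitive_unity_root N q \<longleftrightarrow>
     0 < N \<and> q ^ N = 1 \<and> (\<forall>m. 0 < m \<and> m < N \<longrightarrow> q ^ m \<noteq> 1)"

text \<open>The \<open>q\<close>-Pochhammer symbol \<open>(a)\<^sub>n\<close> with base \<open>q\<close>; in particular \<open>(q)\<^sub>n\<close> is
  \<open>qpoch q q n\<close>.\<close>

definition qpoch :: "'a::comm_ring_1 \<Rightarrow> 'a \<Rightarrow> nat \<Rightarrow> 'a" where
  "qpoch a q n = (\<Prod>k=1..n. 1 - a * q ^ (k - 1))"

text \<open>At a root of unity the quotient of \<open>q\<close>-Pochhammer symbols may have the form \<open>0/0\<close>.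
  The quotient is therefore formed in the ring of polynomials in an indeterminate, where the
  division is exact (\<open>gauss_poly_exact\<close> below), and evaluated at \<open>q\<close> afterwards.\<close>

definition gauss_poly :: "nat \<Rightarrow> nat \<Rightarrow> complex poly" where
  "gauss_poly n k =
     (let X = [:0, 1:] in
      if k \<le> n then qpoch X X n div (qpoch X X (n - k) * qpoch X X k) else 0)"

definition qbinom :: "complex \<Rightarrow> nat \<Rightarrow> nat \<Rightarrow> complex" where
  "qbinom q n k = poly (gauss_poly n k) q"

text \<open>The index tuples \<open>n\<^sub>p \<ge> \<dots> \<ge> n\<^sub>1 \<ge> 0\<close>, as monotone functions on \<open>{1..p}\<close>
  (fixed to be \<open>undefined\<close> elsewhere, so that each tuple occurs once).\<close>

definition tuples :: "nat \<Rightarrow> (nat \<Rightarrow> nat) set" where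
  "tuples p = {n \<in> {1..p} \<rightarrow>\<^sub>E UNIV. mono_on {1..p} n}"

definition H_term :: "nat \<Rightarrow> complex \<Rightarrow> (nat \<Rightarrow> nat) \<Rightarrow> complex" where
  "H_term p q n =
     q ^ n p * qpoch (q ^ (n p + 1)) q (n p + 1) *
     (\<Prod>i=1..p - 1. q ^ (n i * (n i + 1)) * qbinom q (n (i + 1)) (n i))"

definition H :: "nat \<Rightarrow> complex \<Rightarrow> complex" where
  "H p q = (\<Sum>\<^sub>\<infinity>n\<in>tuples p. H_term p q n)"

text \<open>The exponent \<open>k (k - 2) / 3\<close> is an integer whenever \<open>k mod 3 \<noteq> 1\<close>.\<close>

definition alpha :: "complex \<Rightarrow> nat \<Rightarrow> complex" where
  "alpha q k =
     (if k mod 3 = 1 then 0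
      else (-1) ^ ((4 * k + 1) div 3) * q powi ((int k * (int k - 2)) div 3) *
           (\<Sum>i=0..2 * k. q ^ i))"


subsection \<open>Well-definedness\<close>

lemma qpoch_Suc: "qpoch a q (Suc n) = qpoch a q n * (1 - a * q ^ n)"
  by (simp add: qpoch_def)

lemma qpoch_mult_dvd: "qpoch q q m * qpoch q q k dvd qpoch q q (m + k)"
proof (induction "m + k" arbitrary: m k)
  case 0
  then show ?case by (simp add: qpoch_def)
next
  case (Suc n)
  show ?case
  proof (cases "m = 0 \<or> k = 0")
    case True
    then show ?thesis by (auto simp: qpoch_def)
  next
    case False
    then obtain m' k' where mk: "m = Suc m'" "k = Suc k'"
      by (meson not0_implies_Suc)
    have n: "n = m' + k" "n = m + k'" "m + k = Suc n"
      using Suc(2) mk by auto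
    have 1: "qpoch q q m' * qpoch q q k dvd qpoch q q n"
      and 2: "qpoch q q m * qpoch q q k' dvd qpoch q q n"
      using Suc(1)[of m' k] Suc(1)[of m k'] n by auto
    have "qpoch q q m * qpoch q q k dvd (1 - q * q ^ m') * qpoch q q n"
      using mult_dvd_mono[OF dvd_refl[of "1 - q * q ^ m'"] 1] by (simp add: mk(1) qpoch_Suc ac_simps)
    moreover have "qpoch q q m * qpoch q q k dvd (1 - q * q ^ k') * qpoch q q n"
      using mult_dvd_mono[OF dvd_refl[of "1 - q * q ^ k'"] 2] by (simp add: mk(2) qpoch_Suc ac_simps)
    ultimately have "qpoch q q m * qpoch q q k dvd
        (1 - q * q ^ m') * qpoch q q n + q ^ m * ((1 - q * q ^ k') * qpoch q q n)"
      by (rule dvd_add[OF _ dvd_mult])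
    also have "\<dots> = qpoch q q (m + k)"
    proof -
      have "q * q ^ n = q ^ m * (q * q ^ k')" "q ^ m = q * q ^ m'"
        by (simp_all add: n(2) mk(1) power_add)
      then show ?thesis
        unfolding n(3) qpoch_Suc by (simp add: algebra_simps)
    qed
    finally show ?thesis .
  qed
qed

lemma gauss_poly_exact:
  assumes "k \<le> n"
  shows "gauss_poly n k * (qpoch [:0, 1:] [:0, 1:] (n - k) * qpoch [:0, 1:] [:0, 1:] k) =
         qpoch [:0, 1:] [:0, 1:] n"
  using qpoch_mult_dvd[of "[:0, 1:] :: complex poly" "n - k" k] assms
  by (simp add: gauss_poly_def Let_def)

lemma poly_qpoch_X: "poly (qpoch [:0, 1:] [:0, 1:] n) q = qpoch q q n"
  for q :: complex
  by (simp add: qpoch_def poly_prod poly_power)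

lemma qbinom_eq_quotient:
  assumes "k \<le> n" "qpoch q q (n - k) \<noteq> 0" "qpoch q q k \<noteq> 0"
  shows "qbinom q n k = qpoch q q n / (qpoch q q (n - k) * qpoch q q k)"
  using arg_cong[OF gauss_poly_exact[OF assms(1)], of "\<lambda>f. poly f q"] assms
  by (simp add: qbinom_def poly_qpoch_X field_simps)

lemma H_term_eq_0:
  assumes "q ^ N = 1" "0 < N" "N \<le> n p"
  shows "H_term p q n = 0"
proof -
  define r where "r = n p mod N"
  have r: "r < N" "n p + (N - r) = N * (n p div N + 1)"
  proof -
    show r1: "r < N" using assms(2) by (simp add: r_def)
    have "n p = N * (n p div N) + r" by (simp add: r_def)
    then show "n p + (N - r) = N * (n p div N + 1)"
      using r1 unfolding distrib_left by linarith
  qed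
  have "N - r \<in> {1..n p + 1}"
    using r assms by auto
  moreover have "1 - q ^ (n p + 1) * q ^ (N - r - 1) = 0"
  proof -
    have "n p + 1 + (N - r - 1) = n p + (N - r)"
      using r(1) by simp
    then have "q ^ (n p + 1) * q ^ (N - r - 1) = q ^ (n p + (N - r))"
      by (simp only: flip: power_add)
    also have "\<dots> = 1"
      unfolding r(2) using assms(1) by (simp only: power_mult power_one)
    finally show ?thesis by simp
  qed
  ultimately have "qpoch (q ^ (n p + 1)) q (n p + 1) = 0"
    unfolding qpoch_def by (intro prod_zero bexI[of _ "N - r"]) simp_all
  then show ?thesis by (simp add: H_term_def)
qed

lemma finite_H_support:
  assumes "primitive_unity_root N q" "1 \<le> p"
  shows "finite {n \<in> tuples p. H_term p q n \<noteq> 0}"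
proof (rule finite_subset)
  show "{n \<in> tuples p. H_term p q n \<noteq> 0} \<subseteq> {1..p} \<rightarrow>\<^sub>E {..<N}"
  proof
    fix n assume n: "n \<in> {n \<in> tuples p. H_term p q n \<noteq> 0}"
    then have lt: "n p < N"
      using H_term_eq_0[of q N n p] assms(1) by (force simp: primitive_unity_root_def)
    have le: "n i \<le> n p" if "i \<in> {1..p}" for i
    proof -
      have "mono_on {1..p} n" using n by (simp add: tuples_def)
      then show ?thesis by (rule mono_onD) (use that in auto)
    qed
    show "n \<in> {1..p} \<rightarrow>\<^sub>E {..<N}"
    proof (intro PiE_I)
      fix i show "n i \<in> {..<N}" if "i \<in> {1..p}"
        using lt le[OF that] by simp
      show "n i = undefined" if "i \<notin> {1..p}"
      proof -
        have "n \<in> {1..p} \<rightarrow>\<^sub>E UNIV" using n by (simp add: tuples_def)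
        then show ?thesis using that by (rule PiE_arb)
      qed
    qed
  qed
qed (simp add: finite_PiE)

lemma H_eq_finite_sum:
  assumes "primitive_unity_root N q" "1 \<le> p"
  shows "H p q = (\<Sum>n | n \<in> tuples p \<and> H_term p q n \<noteq> 0. H_term p q n)"
  unfolding H_def infsum_finite[OF finite_H_support[OF assms], symmetric]
  by (rule infsum_cong_neutral) auto

end

(* Relative to a = q, the sequences alpha_n and beta_n = q^(n^2-n)/(q)_{2n} form a Bailey pair (due to
   Slater). After p applications of the Bailey lemma with rho_1, rho_2 -> infinity, beta_{N-1} is both
   a p-fold sum over N-1 >= m_1 >= ... >= m_p >= 0 and a single sum over the alpha_k weighted with
   q^(p(k^2+k)). At a primitive N-th root of unity both have a simple pole. The factor 1 - q^N removes
   it, and the limits are the two sides of the theorem up to a constant: the multisum becomes H_p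
   under n_i = N-1-m_i, and (q)_{N-1-k} (q)_k = (-1)^k (q)_{N-1} q^binom(k+1,2) at the root of unity. *)

theory Submission
  imports Defs
begin

section \<open>The q-Vandermonde sum away from roots of unity\<close>

section \<open>Pochhammer symbols at a generic base\<close>

text \<open>Roots of unity are excluded so that every (x)_n is invertible, and zero so that integer
  powers of x obey the exponent laws. The root of unity of the theorem is reached only as a limit of
  such x.\<close>

definition not_unity_root :: "'a::field \<Rightarrow> bool" where
  "not_unity_root x \<longleftrightarrow> x \<noteq> 0 \<and> (\<forall>j>0. x ^ j \<noteq> 1)"

lemma qpoch_0 [simp]: "qpoch a q 0 = 1"
  by (simp add: qpoch_def)

lemma qpoch_add: "qpoch a q (m + k) = qpoch a q m * qpoch (a * q ^ m) q k"
  by (induction k) (simp_all add: qpoch_Suc power_add mult_ac)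

lemma qpoch_nonzero:
  fixes x :: "'a::field"
  assumes "\<And>j. 0 < j \<Longrightarrow> j \<le> n \<Longrightarrow> x ^ j \<noteq> 1"
  shows "qpoch x x n \<noteq> 0"
  using assms
proof (induction n)
  case (Suc n)
  then show ?case using Suc.prems[of "Suc n"] by (simp add: qpoch_Suc)
qed simp

lemma qpoch_nonzero_generic: "not_unity_root x \<Longrightarrow> qpoch x x n \<noteq> 0"
  by (rule qpoch_nonzero) (simp add: not_unity_root_def)

text \<open>Induction on \<open>L\<close> for all \<open>s\<close> at once, splitting 1 - x^(L+1) =
  (1 - x^(L+1-j)) + x^(L+1-j) (1 - x^j). The first part cancels the last factor of (x)_{L+1-j} and
  keeps \<open>s\<close>; the second, after j -> j + 1, raises \<open>s\<close> by one.\<close>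

lemma q_Vandermonde:
  fixes x :: "'a::field"
  assumes "not_unity_root x"
  shows "(\<Sum>j\<le>L. x ^ (j * (j + s)) / (qpoch x x j * qpoch x x (L - j) * qpoch x x (j + s))) =
         1 / (qpoch x x L * qpoch x x (L + s))"
proof (induction L arbitrary: s)
  case 0
  then show ?case by simp
next
  case (Suc L)
  let ?P = "qpoch x x"
  have nz: "?P n \<noteq> 0" for n
    using assms by (rule qpoch_nonzero_generic)
  have nz1: "1 - x * x ^ n \<noteq> 0" for n
    using assms by (metis not_unity_root_def power_Suc right_minus_eq zero_less_Suc)
  define t where "t j = x ^ (j * (j + s)) / (?P j * ?P (Suc L - j) * ?P (j + s))" for j
  have "(1 - x ^ Suc L) * (\<Sum>j\<le>Suc L. t j) =
      (\<Sum>j\<le>Suc L. (1 - x ^ (Suc L - j)) * t j) + (\<Sum>j\<le>Suc L. x ^ (Suc L - j) * (1 - x ^ j) * t j)"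
    unfolding sum_distrib_left sum.distrib[symmetric]
  proof (intro sum.cong refl)
    fix j assume "j \<in> {..Suc L}"
    then have "x ^ Suc L = x ^ (Suc L - j) * x ^ j"
      by (simp del: power_Suc flip: power_add)
    then show "(1 - x ^ Suc L) * t j = (1 - x ^ (Suc L - j)) * t j + x ^ (Suc L - j) * (1 - x ^ j) * t j"
      by (simp add: algebra_simps)
  qed
  also have "(\<Sum>j\<le>Suc L. (1 - x ^ (Suc L - j)) * t j) =
      (\<Sum>j\<le>L. x ^ (j * (j + s)) / (?P j * ?P (L - j) * ?P (j + s)))"
    unfolding sum.atMost_Suc
  proof (simp, intro sum.cong refl)
    fix j assume "j \<in> {..L}"
    then have "Suc L - j = Suc (L - j)" by auto
    then show "(1 - x ^ (Suc L - j)) * t j = x ^ (j * (j + s)) / (?P j * ?P (L - j) * ?P (j + s))"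
      using nz nz1 by (simp add: t_def qpoch_Suc field_simps)
  qed
  also have "\<dots> = 1 / (?P L * ?P (L + s))"
    by (rule Suc.IH)
  also have "(\<Sum>j\<le>Suc L. x ^ (Suc L - j) * (1 - x ^ j) * t j) = x ^ (L + s + 1) *
      (\<Sum>j\<le>L. x ^ (j * (j + Suc s)) / (?P j * ?P (L - j) * ?P (j + Suc s)))"
  proof -
    have "x ^ (Suc L - Suc j) * (1 - x ^ Suc j) * t (Suc j) =
        x ^ (L + s + 1) * (x ^ (j * (j + Suc s)) / (?P j * ?P (L - j) * ?P (j + Suc s)))" if "j \<le> L" for j
    proof -
      have "x ^ (L - j) * x ^ (Suc j * (Suc j + s)) = x ^ (L + s + 1) * x ^ (j * (j + Suc s))"
        using that by (simp only: flip: power_add) (simp add: algebra_simps)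
      moreover have "x ^ (L - j) * (1 - x * x ^ j) * t (Suc j) =
          x ^ (L - j) * x ^ (Suc j * (Suc j + s)) / (?P j * ?P (L - j) * ?P (j + Suc s))"
        using nz nz1[of j] by (simp add: t_def qpoch_Suc[of _ _ j] del: power_Suc)
      ultimately show ?thesis
        by (simp only: diff_Suc_Suc power_Suc times_divide_eq_right)
    qed
    then have "(\<Sum>j\<le>L. x ^ (Suc L - Suc j) * (1 - x ^ Suc j) * t (Suc j)) = x ^ (L + s + 1) *
        (\<Sum>j\<le>L. x ^ (j * (j + Suc s)) / (?P j * ?P (L - j) * ?P (j + Suc s)))"
      unfolding sum_distrib_left by (intro sum.cong refl) (simp only: atMost_iff)
    \<comment> \<open>The term j = 0 contains 1 - x^0 = 0, so the shift of the index loses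
      nothing.\<close>
    then show ?thesis
      by (subst sum.atMost_Suc_shift) simp
  qed
  also have "(\<Sum>j\<le>L. x ^ (j * (j + Suc s)) / (?P j * ?P (L - j) * ?P (j + Suc s))) =
      1 / (?P L * ?P (L + Suc s))"
    by (rule Suc.IH)
  also have "1 / (?P L * ?P (L + s)) + x ^ (L + s + 1) * (1 / (?P L * ?P (L + Suc s))) =
      1 / (?P L * ?P (Suc L + s))"
    using nz nz1[of "L + s"] by (simp add: qpoch_Suc field_simps)
  also have "\<dots> = (1 - x ^ Suc L) * (1 / (?P (Suc L) * ?P (Suc L + s)))"
    using nz nz1[of "L"] by (simp add: qpoch_Suc[of _ _ L])
  finally have "(\<Sum>j\<le>Suc L. t j) = 1 / (?P (Suc L) * ?P (Suc L + s))"
    by (rule mult_left_cancel[THEN iffD1, rotated]) (use nz1[of L] in simp)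
  then show ?case
    by (simp only: t_def)
qed

section \<open>Slater's pair from a telescoping bilateral sum\<close>

section \<open>A Bailey pair\<close>

text \<open>The value \<open>0\<close> at negative integers makes \<open>recip_qpoch_minus_1\<close> hold everywhere, so that
  bilateral sums need no boundary terms.\<close>

definition recip_qpoch :: "'a::field \<Rightarrow> int \<Rightarrow> 'a" where
  "recip_qpoch x k = (if k < 0 then 0 else inverse (qpoch x x (nat k)))"

lemma recip_qpoch_neg: "k < 0 \<Longrightarrow> recip_qpoch x k = 0"
  by (simp add: recip_qpoch_def)

lemma recip_qpoch_of_nat: "recip_qpoch x (int k) = inverse (qpoch x x k)"
  by (simp add: recip_qpoch_def)

lemma recip_qpoch_minus_1:
  assumes "not_unity_root x"
  shows "recip_qpoch x (k - 1) = (1 - x powi k) * recip_qpoch x k"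
proof (cases "k \<le> 0")
  case True
  \<comment> \<open>At k = 0 the factor 1 - x^0 vanishes, in agreement with the value 0 assigned at
    -1.\<close>
  then show ?thesis by (cases "k = 0") (simp_all add: recip_qpoch_def)
next
  case False
  then obtain n where n: "k = int (Suc n)"
    by (metis int_ops(4) not_le zero_less_imp_eq_int gr0_implies_Suc)
  have "1 - x * x ^ n \<noteq> 0"
    using assms by (metis not_unity_root_def power_Suc right_minus_eq zero_less_Suc)
  moreover have "x powi k = x * x ^ n" "k - 1 = int n"
    unfolding n by (simp_all only: power_int_of_nat power_Suc)
  ultimately show ?thesis
    unfolding \<open>k - 1 = int n\<close> recip_qpoch_of_nat \<open>x powi k = _\<close>
    by (simp add: n recip_qpoch_of_nat qpoch_Suc del: of_nat_Suc)
qed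

text \<open>The reflection k -> -1-k exchanges (x)_{n-k} and (x)_{n+k+1}, so one formula serves k =
  3r for r >= 0 and k = -1-3r for r < 0. The factors depending on n alone are 1/beta_n, which
  normalises the bilateral sum to 1.\<close>

definition slater_term :: "'a::field \<Rightarrow> nat \<Rightarrow> int \<Rightarrow> 'a" where
  "slater_term x n r = x powi (3 * r * r - 2 * r - int n * int n + int n) * (1 - x powi (6 * r + 1)) *
     recip_qpoch x (int n - 3 * r) * recip_qpoch x (int n + 3 * r + 1) * qpoch x x (2 * n)"

text \<open>The certificate comes from replacing \<open>q\<close> by \<open>1/q\<close>, which reduces the claim to Schur's finite
  pentagonal sum \<open>\<Sum>\<^sub>j (-1)\<^sup>j q^(j(3j+1)/2) [L, \<lfloor>(L-3j)/2\<rfloor>] = 1\<close>, and composing two of the steps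
  \<open>L \<rightarrow> L + 1\<close> given by the \<open>q\<close>-Pascal rules.\<close>

definition slater_cert :: "'a::field \<Rightarrow> nat \<Rightarrow> int \<Rightarrow> 'a" where
  "slater_cert x n r = - (x powi (3 * r * r - 2 * r - int n * int n - int n) *
     recip_qpoch x (int n + 3 * r - 1) * recip_qpoch x (int n - 3 * r + 1) * qpoch x x (2 * n))"

text \<open>A WZ-type relation: the change in n is a difference in r. After extraction of a common
  factor it is a rational identity in x, a = x^n and b = x^(3r).\<close>

lemma slater_telescope:
  assumes "not_unity_root x"
  shows "slater_term x (Suc n) r - slater_term x n r = slater_cert x n (r + 1) - slater_cert x n r"
proof -
  have x0: "x \<noteq> 0" using assms by (simp add: not_unity_root_def)
  define a b e where "a = x powi (int n)" and "b = x powi (3 * r)"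
    and "e = x powi (3 * r * r - 2 * r - int n * int n - int n)"
  \<comment> \<open>These are the largest arguments that occur. \<open>recip_qpoch_minus_1\<close>
    leads downwards by multiplication only, so it stays valid where the reciprocals are 0.\<close>
  define u v where "u = recip_qpoch x (int n + 1 - 3 * r)" and "v = recip_qpoch x (int n + 3 * r + 2)"
  have b0: "b \<noteq> 0" by (simp add: b_def x0)
  note rec = recip_qpoch_minus_1[OF assms]
  have b2: "x powi (6 * r) = b * b"
    unfolding b_def using x0 by (simp flip: power_int_add)
  have pow: "x powi (int n + 1 - 3 * r) = x * a / b" "x powi (int n - 3 * r) = a / b"
    "x powi (int n - 3 * r - 1) = a / b / x" "x powi (int n + 3 * r + 2) = x * x * a * b"
    "x powi (int n + 3 * r + 1) = x * a * b" "x powi (int n + 3 * r) = a * b"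
    unfolding a_def b_def power_int_add[OF disjI1[OF x0]] power_int_diff[OF disjI1[OF x0]]
    by (simp_all add: power2_eq_square)
  have i1: "int n + 1 - 3 * r - 1 = int n - 3 * r" "int n - 3 * r - 1 - 1 = int n - 3 * r - 2"
    "int n + 3 * r + 2 - 1 = int n + 3 * r + 1" "int n + 3 * r + 1 - 1 = int n + 3 * r"
    by simp_all
  have u1: "recip_qpoch x (int n - 3 * r) = (1 - x * a / b) * u"
    using rec[of "int n + 1 - 3 * r"] unfolding pow i1 u_def .
  have u2: "recip_qpoch x (int n - 3 * r - 1) = (1 - a / b) * (1 - x * a / b) * u"
    using rec[of "int n - 3 * r"] unfolding pow i1 u1 by (simp only: mult.assoc)
  have u3: "recip_qpoch x (int n - 3 * r - 2) = (1 - a / b / x) * (1 - a / b) * (1 - x * a / b) * u"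
    using rec[of "int n - 3 * r - 1"] unfolding pow i1 u2 by (simp only: mult.assoc)
  note u = u1 u2 u3
  have v1: "recip_qpoch x (int n + 3 * r + 1) = (1 - x * x * a * b) * v"
    using rec[of "int n + 3 * r + 2"] unfolding pow i1 v_def .
  have v2: "recip_qpoch x (int n + 3 * r) = (1 - x * a * b) * (1 - x * x * a * b) * v"
    using rec[of "int n + 3 * r + 1"] unfolding pow i1 v1 by (simp only: mult.assoc)
  have v3: "recip_qpoch x (int n + 3 * r - 1) = (1 - a * b) * (1 - x * a * b) * (1 - x * x * a * b) * v"
    using rec[of "int n + 3 * r"] unfolding pow v2 by (simp only: mult.assoc)
  note v = v1 v2 v3
  have e1: "x powi (3 * r * r - 2 * r - int (Suc n) * int (Suc n) + int (Suc n)) = e"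
    by (simp add: e_def algebra_simps)
  have e2: "x powi (3 * r * r - 2 * r - int n * int n + int n) = e * a * a"
    unfolding e_def a_def power_int_add[OF disjI1[OF x0], symmetric] by simp
  have e3: "x powi (3 * (r + 1) * (r + 1) - 2 * (r + 1) - int n * int n - int n) = e * b * b * x"
  proof -
    have "3 * (r + 1) * (r + 1) - 2 * (r + 1) - int n * int n - int n =
        (3 * r * r - 2 * r - int n * int n - int n) + 3 * r + 3 * r + 1"
      by (simp add: algebra_simps)
    then show ?thesis
      by (simp only: power_int_add[OF disjI1[OF x0]] e_def b_def power_int_1_right)
  qed
  have P: "qpoch x x (2 * Suc n) = qpoch x x (2 * n) * (1 - x * a * a) * (1 - x * x * a * a)"
  proof -
    have "x ^ (2 * n) = a * a" "2 * Suc n = Suc (Suc (2 * n))"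
      by (simp_all add: a_def mult_2 power_add)
    then show ?thesis
      by (simp only: qpoch_Suc power_Suc mult.assoc)
  qed
  have c: "x powi (6 * r + 1) = x * b * b"
    using x0 by (simp add: power_int_add b2)
  have i: "int (Suc n) - 3 * r = int n + 1 - 3 * r" "int (Suc n) + 3 * r + 1 = int n + 3 * r + 2"
    "int n + 3 * (r + 1) - 1 = int n + 3 * r + 2" "int n - 3 * (r + 1) + 1 = int n - 3 * r - 2"
    "int n - 3 * r + 1 = int n + 1 - 3 * r"
    by simp_all
  have t1: "slater_term x (Suc n) r =
      e * (1 - x * b * b) * u * v * (qpoch x x (2 * n) * (1 - x * a * a) * (1 - x * x * a * a))"
    unfolding slater_term_def e1 c i P by (simp add: u_def v_def)
  have t2: "slater_term x n r = e * a * a * (1 - x * b * b) * ((1 - x * a / b) * u) *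
      ((1 - x * x * a * b) * v) * qpoch x x (2 * n)"
    unfolding slater_term_def e2 c u v by simp
  have c1: "slater_cert x n (r + 1) = - (e * b * b * x * v *
      ((1 - a / b / x) * (1 - a / b) * (1 - x * a / b) * u) * qpoch x x (2 * n))"
    unfolding slater_cert_def e3 i u by (simp add: v_def)
  have c2: "slater_cert x n r = - (e * ((1 - a * b) * (1 - x * a * b) * (1 - x * x * a * b) * v) * u *
      qpoch x x (2 * n))"
    unfolding slater_cert_def e_def[symmetric] i v by (simp add: u_def)
  \<comment> \<open>The identity without the common factor, which may be 0 and is therefore
    multiplied in afterwards instead of being divided out.\<close>
  have "(1 - x * b * b) * (1 - x * a * a) * (1 - x * x * a * a) -
      a * a * (1 - x * b * b) * (1 - x * a / b) * (1 - x * x * a * b) =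
      - (b * b * x * (1 - a / b / x) * (1 - a / b) * (1 - x * a / b)) +
      (1 - a * b) * (1 - x * a * b) * (1 - x * x * a * b)"
    using x0 b0 by (simp add: field_simps)
  then have "K * ((1 - x * b * b) * (1 - x * a * a) * (1 - x * x * a * a)) -
      K * (a * a * (1 - x * b * b) * (1 - x * a / b) * (1 - x * x * a * b)) =
      - (K * (b * b * x * (1 - a / b / x) * (1 - a / b) * (1 - x * a / b))) +
      K * ((1 - a * b) * (1 - x * a * b) * (1 - x * x * a * b))" for K
    unfolding right_diff_distrib[symmetric] by (simp only: distrib_left mult_minus_right)
  from this[of "e * u * v * qpoch x x (2 * n)"] show ?thesis
    unfolding t1 t2 c1 c2 by (simp only: mult_ac diff_minus_eq_add)
qed

lemma sum_int_telescope:
  fixes f :: "int \<Rightarrow> 'a::ab_group_add"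
  shows "(\<Sum>r\<in>{- int m..<int m}. f (r + 1) - f r) = f (int m) - f (- int m)"
proof (induction m)
  case (Suc m)
  have i: "int (Suc m) = int m + 1" "- (int m + 1) = - int m - 1"
    by simp_all
  have "{- int m - 1..<int m + 1} = insert (int m) (insert (- int m - 1) {- int m..<int m})"
    by auto
  then have "(\<Sum>r\<in>{- int m - 1..<int m + 1}. f (r + 1) - f r) =
      f (int m + 1) - f (int m) + (f (- int m) - f (- int m - 1) + (f (int m) - f (- int m)))"
    using Suc by simp
  also have "\<dots> = f (int m + 1) - f (- int m - 1)"
    by simp
  finally show ?case
    unfolding i .
qed simp

text \<open>The window is wide enough for the certificate to vanish at both ends, so the sum is
  constant in n; at n = 0 only r = 0 contributes.\<close>

lemma sum_slater_term:
  assumes "not_unity_root x" "n < m"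
  shows "(\<Sum>r\<in>{- int m..<int m}. slater_term x n r) = 1"
  using assms(2)
proof (induction n)
  case 0
  have "slater_term x 0 r = 0" if "r \<noteq> 0" for r
    using that by (cases "r < 0") (auto simp: slater_term_def recip_qpoch_neg)
  then have "(\<Sum>r\<in>{- int m..<int m}. slater_term x 0 r) = (\<Sum>r\<in>{0}. slater_term x 0 r)"
    using 0 by (intro sum.mono_neutral_right) auto
  also have "\<dots> = 1"
    using assms(1) recip_qpoch_of_nat[of x 0] recip_qpoch_of_nat[of x 1]
      qpoch_nonzero_generic[OF assms(1), of 1]
    by (simp add: slater_term_def qpoch_def)
  finally show ?case .
next
  case (Suc n)
  have "(\<Sum>r\<in>{- int m..<int m}. slater_term x (Suc n) r) - (\<Sum>r\<in>{- int m..<int m}. slater_term x n r) =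
      slater_cert x n (int m) - slater_cert x n (- int m)"
    unfolding sum_subtractf[symmetric] slater_telescope[OF assms(1)] by (rule sum_int_telescope)
  also have "\<dots> = 0"
    using Suc.prems by (simp add: slater_cert_def recip_qpoch_neg)
  finally show ?case using Suc by simp
qed

text \<open>The indices \<open>k = 3 r\<close> and \<open>k = 3 r + 2 = - 1 - 3 (- r - 1)\<close> of \<^const>\<open>alpha\<close> together
  form one bilateral sum over \<open>3 \<int>\<close>.\<close>

lemma alpha_0_mod_3: "(1 - x) * alpha x (3 * r) = x powi (3 * int r * int r - 2 * int r) * (1 - x powi (6 * int r + 1))"
proof -
  have "(1 - x) * (\<Sum>i=0..2 * (3 * r). x ^ i) = 1 - x ^ Suc (2 * (3 * r))"
    using sum_gp_multiplied[of 0 "2 * (3 * r)" x] by simp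
  also have "x ^ Suc (2 * (3 * r)) = x powi (6 * int r + 1)"
    by (subst power_int_of_nat[symmetric]) (simp add: algebra_simps)
  finally have g: "(1 - x) * (\<Sum>i=0..2 * (3 * r). x ^ i) = 1 - x powi (6 * int r + 1)" .
  have s: "(4 * (3 * r) + 1) div 3 = 2 * (2 * r)" by simp
  have "int (3 * r) * (int (3 * r) - 2) = 3 * (3 * int r * int r - 2 * int r)"
    by (simp add: algebra_simps)
  then have d: "int (3 * r) * (int (3 * r) - 2) div 3 = 3 * int r * int r - 2 * int r"
    by simp
  have "alpha x (3 * r) = x powi (3 * int r * int r - 2 * int r) * (\<Sum>i=0..2 * (3 * r). x ^ i)"
    unfolding alpha_def d s power_mult by simp
  then show ?thesis unfolding g[symmetric] by (simp only: mult_ac)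
qed

lemma alpha_2_mod_3:
  assumes "not_unity_root x"
  shows "(1 - x) * alpha x (3 * r + 2) =
    x powi (3 * (- int r - 1) * (- int r - 1) - 2 * (- int r - 1)) * (1 - x powi (6 * (- int r - 1) + 1))"
proof -
  have x0: "x \<noteq> 0" using assms by (simp add: not_unity_root_def)
  have "(1 - x) * (\<Sum>i=0..2 * (3 * r + 2). x ^ i) = 1 - x ^ Suc (2 * (3 * r + 2))"
    using sum_gp_multiplied[of 0 "2 * (3 * r + 2)" x] by simp
  also have "x ^ Suc (2 * (3 * r + 2)) = x powi (6 * int r + 5)"
    by (subst power_int_of_nat[symmetric]) (simp add: algebra_simps)
  finally have g: "(1 - x) * (\<Sum>i=0..2 * (3 * r + 2). x ^ i) = 1 - x powi (6 * int r + 5)" .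
  have s: "(4 * (3 * r + 2) + 1) div 3 = 2 * (2 * r + 1) + 1" by simp
  have sg: "(- 1) ^ (2 * (2 * r + 1) + 1) = (- 1 :: complex)" by simp
  have "int (3 * r + 2) * (int (3 * r + 2) - 2) = 3 * (3 * int r * int r + 2 * int r)"
    by (simp add: algebra_simps)
  then have d: "int (3 * r + 2) * (int (3 * r + 2) - 2) div 3 = 3 * int r * int r + 2 * int r"
    by simp
  have m: "(3 * r + 2) mod 3 = 2" by presburger
  have "alpha x (3 * r + 2) = - (x powi (3 * int r * int r + 2 * int r) * (\<Sum>i=0..2 * (3 * r + 2). x ^ i))"
    unfolding alpha_def d s m sg by simp
  then have "(1 - x) * alpha x (3 * r + 2) =
      - (x powi (3 * int r * int r + 2 * int r) * (1 - x powi (6 * int r + 5)))"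
    unfolding g[symmetric] by (simp only: mult_ac mult_minus_right)
  \<comment> \<open>The sign is absorbed by -(1 - y) = y (1 - 1/y) with y = x^(6r+5).\<close>
  also have "\<dots> = x powi (3 * int r * int r + 2 * int r + (6 * int r + 5)) *
     (1 - x powi (- (6 * int r + 5)))"
  proof -
    have "x powi (6 * int r + 5) \<noteq> 0" using x0 by simp
    then show ?thesis
      using x0 unfolding power_int_minus power_int_add[OF disjI1[OF x0], of _ "6 * int r + 5"]
      by (simp add: algebra_simps)
  qed
  finally show ?thesis by (simp add: algebra_simps)
qed

lemma alpha_1_mod_3: "alpha x (3 * r + 1) = 0"
proof -
  have "(3 * r + 1) mod 3 = 1" by presburger
  then show ?thesis by (simp add: alpha_def)
qed

text \<open>The Bailey pair relation relative to a = x has the denominator (x^2)_{n+k} = (x)_{n+k+1}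
  / (1 - x), whence the factor 1 - x. Divided by beta_n, the sum over k becomes the bilateral sum of
  \<open>slater_term\<close>.\<close>

lemma slater_bailey_pair:
  assumes "not_unity_root x"
  shows "(\<Sum>k\<le>n. (1 - x) * alpha x k / (qpoch x x (n - k) * qpoch x x (n + k + 1))) =
         x ^ (n * (n - 1)) / qpoch x x (2 * n)"
proof -
  have x0: "x \<noteq> 0" using assms by (simp add: not_unity_root_def)
  define f where "f k = (1 - x) * alpha x k * recip_qpoch x (int n - int k) *
    recip_qpoch x (int n + int k + 1) * (qpoch x x (2 * n) * x powi (int n - int n * int n))" for k
  have f0: "f (3 * r) = slater_term x n (int r)" for r
    unfolding f_def slater_term_def alpha_0_mod_3
    using x0 by (simp add: power_int_add power_int_diff field_simps)
  have f1: "f (3 * r + 1) = 0" for r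
    unfolding f_def alpha_1_mod_3 by simp
  have f2: "f (3 * r + 2) = slater_term x n (- int r - 1)" for r
  proof -
    have i: "int n - 3 * (- int r - 1) = int n + int (3 * r + 2) + 1"
      "int n + 3 * (- int r - 1) + 1 = int n - int (3 * r + 2)"
      by simp_all
    have e: "x powi (3 * (- int r - 1) * (- int r - 1) - 2 * (- int r - 1) - int n * int n + int n) =
      x powi (3 * (- int r - 1) * (- int r - 1) - 2 * (- int r - 1)) * x powi (int n - int n * int n)"
      unfolding power_int_add[OF disjI1[OF x0], symmetric] by (simp add: algebra_simps)
    show ?thesis
      unfolding f_def slater_term_def alpha_2_mod_3[OF assms] i e by (simp add: mult_ac)
  qed
  \<comment> \<open>Each block 3m, 3m+1, 3m+2 adds the two new end points r = m and r = -m-1 of the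
    window; the middle index contributes 0.\<close>
  have fold: "(\<Sum>k<3 * m. f k) = (\<Sum>r\<in>{- int m..<int m}. slater_term x n r)" for m
  proof (induction m)
    case (Suc m)
    have "{- int (Suc m)..<int (Suc m)} = insert (int m) (insert (- int m - 1) {- int m..<int m})"
      by auto
    moreover have "(\<Sum>k<3 * Suc m. f k) = (\<Sum>k<3 * m. f k) + f (3 * m) + f (3 * m + 1) + f (3 * m + 2)"
      by (simp add: numeral_3_eq_3)
    ultimately show ?case using Suc f0[of m] f1[of m] f2[of m] by (simp add: algebra_simps)
  qed simp
  \<comment> \<open>Indices k > n are harmless because \<open>recip_qpoch\<close> is 0 at n - k <
    0.\<close>
  have "(\<Sum>k\<le>n. f k) = (\<Sum>k<3 * Suc n. f k)"
    by (rule sum.mono_neutral_left) (auto simp: f_def recip_qpoch_neg)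
  also have "\<dots> = 1"
    unfolding fold by (rule sum_slater_term[OF assms]) simp
  finally have 1: "(\<Sum>k\<le>n. f k) = 1" .
  have "f k = (1 - x) * alpha x k / (qpoch x x (n - k) * qpoch x x (n + k + 1)) *
      (qpoch x x (2 * n) * x powi (int n - int n * int n))" if "k \<le> n" for k
  proof -
    have i: "int n - int k = int (n - k)" "int n + int k + 1 = int (n + k + 1)"
      using that by simp_all
    show ?thesis unfolding f_def i recip_qpoch_of_nat by (simp add: field_simps)
  qed
  then have "(\<Sum>k\<le>n. (1 - x) * alpha x k / (qpoch x x (n - k) * qpoch x x (n + k + 1))) *
      (qpoch x x (2 * n) * x powi (int n - int n * int n)) = 1"
    using 1 by (simp add: sum_distrib_right)
  moreover have "x powi (int n - int n * int n) * x ^ (n * (n - 1)) = 1"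
  proof -
    have "int (n * (n - 1)) = - (int n - int n * int n)"
      by (cases n) (simp_all add: algebra_simps)
    then show ?thesis
      unfolding power_int_of_nat[symmetric] power_int_add[OF disjI1[OF x0], symmetric] by simp
  qed
  moreover have "S = z / P" if "S * (P * y) = 1" "y * z = 1" "P \<noteq> 0" for S P y z :: complex
  proof -
    have "S = S * (y * z)"
      unfolding that(2) by simp
    also have "\<dots> = S * (P * y) * z / P"
      using that(3) by simp
    finally show ?thesis
      unfolding that(1) by simp
  qed
  ultimately show ?thesis
    using qpoch_nonzero_generic[OF assms, of "2 * n"] by blast
qed

section \<open>The Bailey lemma relative to a = x with both parameters at infinity\<close>

section \<open>Iterating the Bailey lemma\<close>

text \<open>Expanding \<open>b k\<close>, exchanging the sums and putting k = i + j leaves an inner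
  sum over i, which is \<open>q_Vandermonde\<close> with L = n - j and s = 2j + 1.\<close>

lemma bailey_lemma_step:
  fixes x :: "'a::field"
  assumes "not_unity_root x"
    and pair: "\<And>n. (\<Sum>k\<le>n. a k / (qpoch x x (n - k) * qpoch x x (n + k + 1))) = b n"
  shows "(\<Sum>k\<le>n. x ^ (k\<^sup>2 + k) * a k / (qpoch x x (n - k) * qpoch x x (n + k + 1))) =
         (\<Sum>k\<le>n. x ^ (k\<^sup>2 + k) / qpoch x x (n - k) * b k)"
proof -
  let ?P = "qpoch x x"
  let ?f = "\<lambda>k j. x ^ (k\<^sup>2 + k) / ?P (n - k) * (a j / (?P (k - j) * ?P (k + j + 1)))"
  have "(\<Sum>k\<le>n. x ^ (k\<^sup>2 + k) / ?P (n - k) * b k) = (\<Sum>k\<le>n. \<Sum>j\<le>k. ?f k j)"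
    unfolding pair[symmetric] sum_distrib_left ..
  also have "\<dots> = (\<Sum>j\<le>n. \<Sum>i\<le>n - j. ?f (i + j) j)"
    unfolding sum.Sigma[OF finite_atMost ballI[OF finite_atMost]]
    by (rule sum.reindex_bij_witness[of _ "\<lambda>(j, i). (i + j, j)" "\<lambda>(k, j). (j, k - j)"]) auto
  also have "\<dots> = (\<Sum>j\<le>n. x ^ (j\<^sup>2 + j) * a j / (?P (n - j) * ?P (n + j + 1)))"
  proof (intro sum.cong refl)
    fix j assume "j \<in> {..n}"
    then have j: "j \<le> n" by simp
    have "?f (i + j) j = x ^ (j\<^sup>2 + j) * a j *
        (x ^ (i * (i + (2 * j + 1))) / (?P i * ?P (n - j - i) * ?P (i + (2 * j + 1))))"
      if "i \<le> n - j" for i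
    proof -
      have e: "(i + j)\<^sup>2 + (i + j) = (j\<^sup>2 + j) + i * (i + (2 * j + 1))"
        by (simp add: power2_eq_square algebra_simps)
      have i: "n - (i + j) = n - j - i" "i + j - j = i" "i + j + j + 1 = i + (2 * j + 1)"
        by simp_all
      show ?thesis
        unfolding e i power_add[of x "j\<^sup>2 + j"] by (simp add: mult_ac)
    qed
    then have "(\<Sum>i\<le>n - j. ?f (i + j) j) = x ^ (j\<^sup>2 + j) * a j *
        (\<Sum>i\<le>n - j. x ^ (i * (i + (2 * j + 1))) / (?P i * ?P (n - j - i) * ?P (i + (2 * j + 1))))"
      unfolding sum_distrib_left by (intro sum.cong refl) (simp only: atMost_iff)
    also have "\<dots> = x ^ (j\<^sup>2 + j) * a j * (1 / (?P (n - j) * ?P (n - j + (2 * j + 1))))"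
      by (simp only: q_Vandermonde[OF assms(1)])
    also have "n - j + (2 * j + 1) = n + j + 1"
      using j by simp
    finally show "(\<Sum>i\<le>n - j. ?f (i + j) j) = x ^ (j\<^sup>2 + j) * a j / (?P (n - j) * ?P (n + j + 1))"
      by simp
  qed
  finally show ?thesis ..
qed

primrec bailey_beta :: "nat \<Rightarrow> nat \<Rightarrow> complex \<Rightarrow> complex" where
  "bailey_beta 0 n x = x ^ (n * (n - 1)) / qpoch x x (2 * n)"
| "bailey_beta (Suc p) n x = (\<Sum>k\<le>n. x ^ (k\<^sup>2 + k) / qpoch x x (n - k) * bailey_beta p k x)"

lemma bailey_beta_eq:
  assumes "not_unity_root x"
  shows "(\<Sum>k\<le>n. x ^ (p * (k\<^sup>2 + k)) * ((1 - x) * alpha x k) / (qpoch x x (n - k) * qpoch x x (n + k + 1))) =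
         bailey_beta p n x"
proof (induction p arbitrary: n)
  case 0
  then show ?case using slater_bailey_pair[OF assms, of n] by simp
next
  case (Suc p)
  have "x ^ (Suc p * (k\<^sup>2 + k)) * ((1 - x) * alpha x k) =
      x ^ (k\<^sup>2 + k) * (x ^ (p * (k\<^sup>2 + k)) * ((1 - x) * alpha x k))" for k
    by (simp add: power_add mult_ac)
  then show ?case
    unfolding bailey_beta.simps by (simp only: bailey_lemma_step[OF assms Suc.IH])
qed

section \<open>The multisum as an iterated transfer operator\<close>

section \<open>Peeling off the largest index\<close>

text \<open>Transfer operator that sums out the largest index and passes its weight on to the next
  smaller one. The constraint n >= m is left to the vanishing of \<open>qbinom\<close>.\<close>

definition peel :: "complex \<Rightarrow> nat \<Rightarrow> (nat \<Rightarrow> complex) \<Rightarrow> nat \<Rightarrow> complex" where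
  "peel q N F m = q ^ (m * (m + 1)) * (\<Sum>n<N. qbinom q n m * F n)"

text \<open>The top index is split off and summed first, which replaces \<open>F\<close> by
  \<open>peel q N F\<close>; hence the induction has to range over all \<open>F\<close>.\<close>

lemma sum_PiE_peel:
  "(\<Sum>n\<in>{1..Suc p} \<rightarrow>\<^sub>E {..<N}. F (n (Suc p)) *
      (\<Prod>i=1..p. q ^ (n i * (n i + 1)) * qbinom q (n (i + 1)) (n i))) =
   (\<Sum>m<N. (peel q N ^^ p) F m)"
proof (induction p arbitrary: F)
  case 0
  have "(\<Sum>n\<in>{1..Suc 0} \<rightarrow>\<^sub>E {..<N}. F (n (Suc 0))) = (\<Sum>m<N. F m)"
    by (rule sum.reindex_bij_witness[of _ "\<lambda>m. \<lambda>i\<in>{1..Suc 0}. m" "\<lambda>n. n (Suc 0)"])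
      (auto simp: PiE_iff extensional_def fun_eq_iff)
  then show ?case by simp
next
  case (Suc p)
  let ?w = "\<lambda>n i. q ^ (n i * (n i + 1)) * qbinom q (n (i + 1)) (n i)"
  let ?A = "{1..Suc p} \<rightarrow>\<^sub>E {..<N}"
  have ins: "{1..Suc (Suc p)} = insert (Suc (Suc p)) {1..Suc p}"
    by auto
  have "(\<Sum>n\<in>{1..Suc (Suc p)} \<rightarrow>\<^sub>E {..<N}. F (n (Suc (Suc p))) * (\<Prod>i=1..Suc p. ?w n i)) =
      (\<Sum>(l, n)\<in>{..<N} \<times> ?A. F l * (\<Prod>i=1..Suc p. ?w (n(Suc (Suc p) := l)) i))"
    unfolding ins PiE_insert_eq
    by (subst sum.reindex[OF inj_combinator]) (auto intro!: sum.cong)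
  also have "\<dots> = (\<Sum>(l, n)\<in>{..<N} \<times> ?A. F l * (q ^ (n (Suc p) * (n (Suc p) + 1)) *
      qbinom q l (n (Suc p))) * (\<Prod>i=1..p. ?w n i))"
  proof (intro sum.cong refl, clarify)
    fix l n
    have "(\<Prod>i=1..Suc p. ?w (n(Suc (Suc p) := l)) i) =
        (\<Prod>i=1..p. ?w (n(Suc (Suc p) := l)) i) * ?w (n(Suc (Suc p) := l)) (Suc p)"
      by (subst prod.nat_ivl_Suc') (simp, rule mult.commute)
    also have "(\<Prod>i=1..p. ?w (n(Suc (Suc p) := l)) i) = (\<Prod>i=1..p. ?w n i)"
      by (intro prod.cong) auto
    finally show "F l * (\<Prod>i=1..Suc p. ?w (n(Suc (Suc p) := l)) i) =
        F l * (q ^ (n (Suc p) * (n (Suc p) + 1)) * qbinom q l (n (Suc p))) * (\<Prod>i=1..p. ?w n i)"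
      by simp
  qed
  also have "\<dots> = (\<Sum>n\<in>?A. \<Sum>l<N. F l * (q ^ (n (Suc p) * (n (Suc p) + 1)) *
      qbinom q l (n (Suc p))) * (\<Prod>i=1..p. ?w n i))"
    unfolding sum.cartesian_product[symmetric] by (rule sum.swap)
  also have "\<dots> = (\<Sum>n\<in>?A. peel q N F (n (Suc p)) * (\<Prod>i=1..p. ?w n i))"
    unfolding peel_def sum_distrib_left sum_distrib_right by (simp add: mult_ac)
  also have "\<dots> = (\<Sum>m<N. (peel q N ^^ p) (peel q N F) m)"
    by (rule Suc.IH)
  finally show ?case
    by (simp add: funpow_swap1)
qed

lemma qbinom_eq_0: "n < k \<Longrightarrow> qbinom q n k = 0"
  by (simp add: qbinom_def gauss_poly_def)

text \<open>A non-monotone tuple descends between two neighbours, where the Gaussian binomial is 0.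
  This permits sums over a full box of tuples.\<close>

lemma H_term_eq_0_of_not_mono:
  assumes "\<not> mono_on {1..p} n"
  shows "H_term p q n = 0"
proof -
  have "\<exists>i\<in>{1..p - 1}. n (i + 1) < n i"
  proof (rule ccontr)
    assume "\<not> ?thesis"
    then have step: "n i \<le> n (Suc i)" if "1 \<le> i" "Suc i \<le> p" for i
      using that by force
    have "n r \<le> n s" if "1 \<le> r" "r \<le> s" "s \<le> p" for r s
      using that(2,3)
    proof (induction s rule: dec_induct)
      case (step s)
      then show ?case using \<open>\<And>i. 1 \<le> i \<Longrightarrow> Suc i \<le> p \<Longrightarrow> n i \<le> n (Suc i)\<close>[of s] that(1) by simp
    qed simp
    then have "mono_on {1..p} n"
      by (intro mono_onI) auto
    then show False using assms by simp
  qed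
  then obtain i where "i \<in> {1..p - 1}" "qbinom q (n (i + 1)) (n i) = 0"
    using qbinom_eq_0 by blast
  then have "(\<Prod>i=1..p - 1. q ^ (n i * (n i + 1)) * qbinom q (n (i + 1)) (n i)) = 0"
    by (intro prod_zero) (auto intro!: bexI[of _ i])
  then show ?thesis
    by (simp add: H_term_def)
qed

text \<open>Monotone tuples outside the box have n_p >= N and vanish by \<open>H_term_eq_0\<close>;
  non-monotone tuples inside it contribute 0.\<close>

lemma H_eq_sum_peel:
  assumes "q ^ N = 1" "0 < N"
  shows "H (Suc p) q = (\<Sum>m<N. (peel q N ^^ p) (\<lambda>n. q ^ n * qpoch (q ^ (n + 1)) q (n + 1)) m)"
proof -
  let ?A = "{1..Suc p} \<rightarrow>\<^sub>E {..<N}"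
  have "H (Suc p) q = infsum (H_term (Suc p) q) ?A"
    unfolding H_def
  proof (rule infsum_cong_neutral)
    fix n assume n: "n \<in> tuples (Suc p) - ?A"
    then have mono: "mono_on {1..Suc p} n" and "n \<in> {1..Suc p} \<rightarrow>\<^sub>E UNIV"
      by (simp_all add: tuples_def)
    then obtain i where i: "i \<in> {1..Suc p}" "N \<le> n i"
      using n by (auto simp: PiE_iff not_less)
    then have "n i \<le> n (Suc p)"
      by (intro mono_onD[OF mono]) auto
    then show "H_term (Suc p) q n = 0"
      using H_term_eq_0[of q N n "Suc p"] assms i by simp
  next
    fix n assume "n \<in> ?A - tuples (Suc p)"
    then have "\<not> mono_on {1..Suc p} n"
      by (auto simp: tuples_def PiE_iff)
    then show "H_term (Suc p) q n = 0"
      by (rule H_term_eq_0_of_not_mono)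
  qed simp
  also have "\<dots> = sum (H_term (Suc p) q) ?A"
    by (simp add: finite_PiE)
  also have "\<dots> = (\<Sum>m<N. (peel q N ^^ p) (\<lambda>n. q ^ n * qpoch (q ^ (n + 1)) q (n + 1)) m)"
    unfolding sum_PiE_peel[symmetric] by (simp add: H_term_def)
  finally show ?thesis .
qed

section \<open>Simple poles, reflection, and the two evaluations of the limit\<close>

section \<open>The limit at a root of unity\<close>

text \<open>Isolates the factor 1 - x^N, which is responsible for the pole.\<close>

lemma qpoch_past_order:
  assumes "0 < N"
  shows "qpoch x x (N + k) = qpoch x x (N - 1) * (1 - x ^ N) * qpoch (x * x ^ N) x k"
proof -
  have "qpoch x x N = qpoch x x (N - 1) * (1 - x ^ N)"
    using assms by (cases N) (simp_all add: qpoch_Suc)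
  then show ?thesis by (simp add: qpoch_add)
qed

lemma tendsto_qpoch [tendsto_intros]:
  fixes a x :: "'b \<Rightarrow> 'a::real_normed_field"
  assumes "(a \<longlongrightarrow> b) F" "(x \<longlongrightarrow> y) F"
  shows "((\<lambda>i. qpoch (a i) (x i) n) \<longlongrightarrow> qpoch b y n) F"
  unfolding qpoch_def by (intro tendsto_intros assms)

lemma tendsto_alpha:
  assumes "(x \<longlongrightarrow> y) F" "y \<noteq> 0"
  shows "((\<lambda>i. alpha (x i) k) \<longlongrightarrow> alpha y k) F"
  unfolding alpha_def using assms by (cases "k mod 3 = 1") (auto intro!: tendsto_intros)

text \<open>Moving q radially into the unit disc gives points of norm strictly between 0 and 1, none
  of whose positive powers is 1.\<close>

lemma primitive_unity_root_approx:
  assumes "primitive_unity_root N q"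
  obtains X where "X \<longlonglongrightarrow> q" "\<And>i. not_unity_root (X i)"
proof
  define X where "X i = q * (of_nat (Suc i) / of_nat (Suc (Suc i)))" for i
  have "(\<lambda>i. of_nat (Suc i) / of_nat (Suc (Suc i)) :: complex) \<longlonglongrightarrow> 1"
    by (rule LIMSEQ_Suc[OF LIMSEQ_n_over_Suc_n])
  from tendsto_mult[OF tendsto_const[of q] this] show "X \<longlonglongrightarrow> q"
    unfolding X_def by simp
  have "norm q ^ N = 1" "0 < N"
    using assms by (simp_all add: primitive_unity_root_def flip: norm_power)
  then have nq: "norm q = 1"
    by (intro power_eq_imp_eq_base[of _ N 1]) simp_all
  fix i
  have "norm (X i) = real (Suc i) / real (Suc (Suc i))"
    by (simp only: X_def norm_mult norm_divide norm_of_nat nq mult_1)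
  then have "0 < norm (X i)" "norm (X i) < 1"
    by simp_all
  moreover have "X i ^ j \<noteq> 1" if "0 < j" for j
  proof
    assume "X i ^ j = 1"
    then have "norm (X i) ^ j = 1" by (simp flip: norm_power)
    moreover have "norm (X i) ^ j < 1"
      using that \<open>norm (X i) < 1\<close> by (simp add: power_less_one_iff)
    ultimately show False by simp
  qed
  ultimately show "not_unity_root (X i)"
    by (auto simp: not_unity_root_def)
qed

text \<open>Since q^N = 1, factors at opposite ends are related by 1 - q^(j+1) = -q^(j+1) (1 -
  q^(N-1-j)); each induction step trades one for the other.\<close>

lemma qpoch_reflect:
  fixes q :: "'a::field"
  assumes "q ^ N = 1" "j < N"
  shows "qpoch q q (N - 1 - j) * qpoch q q j * (- 1) ^ j = qpoch q q (N - 1) * q ^ ((j + 1) choose 2)"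
  using assms(2)
proof (induction j)
  case 0
  then show ?case by (simp add: numeral_2_eq_2)
next
  case (Suc j)
  define k where "k = N - 1 - Suc j"
  have k: "N - 1 - j = Suc k" using Suc.prems by (simp add: k_def)
  have "q * q ^ j * (q * q ^ k) = q ^ N"
  proof -
    have "N = Suc j + Suc k" using Suc.prems by (simp add: k_def)
    then show ?thesis by (simp add: power_add)
  qed
  then have "1 - q * q ^ j = - (q * q ^ j) * (1 - q * q ^ k)"
    using assms(1) by (simp add: algebra_simps)
  then have "qpoch q q k * qpoch q q (Suc j) * (- 1) ^ Suc j =
      qpoch q q (Suc k) * qpoch q q j * (- 1) ^ j * (q * q ^ j)"
    unfolding qpoch_Suc by (simp add: mult_ac)
  also have "\<dots> = qpoch q q (N - 1) * (q ^ ((j + 1) choose 2) * (q * q ^ j))"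
    using Suc.IH Suc.prems unfolding k by simp
  also have "q ^ ((j + 1) choose 2) * (q * q ^ j) = q ^ ((Suc j + 1) choose 2)"
  proof -
    have "(Suc j + 1) choose 2 = ((j + 1) choose 2) + Suc j"
      by (simp add: numeral_2_eq_2)
    then show ?thesis
      by (simp only: power_add power_Suc)
  qed
  finally show ?case unfolding k_def .
qed

text \<open>Congruence of exponents modulo N without subtraction: \<open>t\<close> is a common
  complement of \<open>s\<close> and \<open>u\<close>.\<close>

lemma root_of_unity_power_cong:
  fixes q :: "'a::field"
  assumes "q ^ N = 1" "s + t = N * c" "u + t = N * d"
  shows "q ^ s = q ^ u"
proof -
  have "q ^ s * q ^ t = 1" "q ^ u * q ^ t = 1"
    using assms by (simp_all add: power_mult flip: power_add)
  then show ?thesis by (metis mult_cancel_right mult_zero_right zero_neq_one)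
qed

text \<open>One sequence is fixed so that both evaluations are limits of the same expression and can
  be equated.\<close>

locale approximated_unity_root =
  fixes N :: nat and q :: complex and X :: "nat \<Rightarrow> complex"
  assumes primitive: "primitive_unity_root N q"
    and lim_X: "X \<longlonglongrightarrow> q"
    and generic_X: "\<And>i. not_unity_root (X i)"
begin

abbreviation "P \<equiv> qpoch q q"

lemma N_pos: "0 < N" and q_N: "q ^ N = 1" and q_nonzero: "q \<noteq> 0"
  using primitive by (auto simp: primitive_unity_root_def power_0_left)

lemma P_nonzero: "n < N \<Longrightarrow> P n \<noteq> 0"
  using primitive by (intro qpoch_nonzero) (auto simp: primitive_unity_root_def)

lemma X_N_neq: "1 - X i ^ N \<noteq> 0"
  using generic_X[of i] N_pos by (auto simp: not_unity_root_def)

lemma lim_vanishing: "(\<lambda>i. 1 - X i ^ N) \<longlonglongrightarrow> 0"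
  using tendsto_diff[OF tendsto_const[of 1] tendsto_power[OF lim_X, of N]] by (simp add: q_N)

lemma lim_pole:
  assumes "k < N"
  shows "(\<lambda>i. (1 - X i ^ N) / qpoch (X i) (X i) (N + k)) \<longlonglongrightarrow> 1 / (P (N - 1) * P k)"
proof -
  have "(\<lambda>i. 1 / (qpoch (X i) (X i) (N - 1) * qpoch (X i * X i ^ N) (X i) k)) \<longlonglongrightarrow>
      1 / (P (N - 1) * qpoch (q * q ^ N) q k)"
    using P_nonzero[OF assms] P_nonzero[of "N - 1"] N_pos
    by (intro tendsto_intros lim_X) (simp add: q_N)
  then show ?thesis
    unfolding qpoch_past_order[OF N_pos] using X_N_neq by (simp add: q_N)
qed

abbreviation "top_weight \<equiv> \<lambda>n. q ^ n * qpoch (q ^ (n + 1)) q (n + 1)"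

text \<open>Collects what \<open>lim_bailey_beta_0\<close> leaves over: the sign of a reflection at
  an odd index, one power of q, and (q)_{N-1} once from the pole and once from the
  reflection.\<close>

abbreviation "const \<equiv> - q / (P (N - 1))\<^sup>2"

text \<open>On the right, (q)_m and the Pochhammer symbol of \<open>top_weight\<close> join to
  (q)_{2m+1}. If 2k < N there is no pole and both sides are 0, because 2m+1 >= N. Otherwise the pole
  is simple and \<open>qpoch_reflect\<close> at 2m+1 evaluates the limit.\<close>

lemma lim_bailey_beta_0:
  assumes "m < N"
  defines "k \<equiv> N - 1 - m"
  shows "(\<lambda>i. (1 - X i ^ N) * X i ^ (k\<^sup>2 + k) * bailey_beta 0 k (X i)) \<longlonglongrightarrow>
         const * top_weight m * P m"
proof -
  have km: "k + (m + 1) = N" using assms by (simp add: k_def)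
  have top: "top_weight m * P m = q ^ m * P (2 * m + 1)"
  proof -
    have "2 * m + 1 = m + (m + 1)" "q ^ (m + 1) = q * q ^ m"
      by simp_all
    then show ?thesis
      by (simp only: qpoch_add[of q q m "m + 1"] mult_ac)
  qed
  show ?thesis
  proof (cases "2 * k < N")
    case True
    have "P (2 * k) \<noteq> 0"
      by (rule P_nonzero) (rule True)
    then have "(\<lambda>i. (1 - X i ^ N) * X i ^ (k\<^sup>2 + k) * (X i ^ (k * (k - 1)) / qpoch (X i) (X i) (2 * k)))
      \<longlonglongrightarrow> 0 * q ^ (k\<^sup>2 + k) * (q ^ (k * (k - 1)) / P (2 * k))"
      by (intro tendsto_intros lim_X lim_vanishing)
    moreover have vanish: "P (2 * m + 1) = 0"
    proof -
      have "2 * m + 1 = N + (2 * m + 1 - N)" using True km by simp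
      then show ?thesis
        using qpoch_past_order[OF N_pos, of q "2 * m + 1 - N"] by (simp add: q_N)
    qed
    moreover have "const * top_weight m * P m = 0"
      unfolding mult.assoc[of const] top vanish by simp
    ultimately show ?thesis
      by (simp only: bailey_beta.simps mult_zero_left)
  next
    case False
    define r where "r = 2 * k - N"
    have r: "2 * k = N + r" "N - 1 - (2 * m + 1) = r" "2 * m + 1 < N"
      using False km by (simp_all add: r_def)
    have "r < N" using r by simp
    have "(\<lambda>i. (1 - X i ^ N) / qpoch (X i) (X i) (N + r) * (X i ^ (k\<^sup>2 + k) * X i ^ (k * (k - 1))))
      \<longlonglongrightarrow> 1 / (P (N - 1) * P r) * (q ^ (k\<^sup>2 + k) * q ^ (k * (k - 1)))"
      by (intro tendsto_intros lim_X lim_pole \<open>r < N\<close>)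
    then have "(\<lambda>i. (1 - X i ^ N) * X i ^ (k\<^sup>2 + k) * bailey_beta 0 k (X i))
      \<longlonglongrightarrow> 1 / (P (N - 1) * P r) * (q ^ (k\<^sup>2 + k) * q ^ (k * (k - 1)))"
      unfolding bailey_beta.simps r(1) by (simp add: mult_ac)
    also have "q ^ (k\<^sup>2 + k) * q ^ (k * (k - 1)) = q ^ (2 * (k * k))"
    proof -
      have "2 * (k * k) = k\<^sup>2 + k + k * (k - 1)"
        by (cases k) (simp_all add: power2_eq_square)
      then show ?thesis by (simp only: power_add)
    qed
    \<comment> \<open>Here k is congruent to -(m+1) modulo N.\<close>
    also have "\<dots> = q ^ (2 * ((m + 1) * (m + 1)))"
    proof (rule root_of_unity_power_cong[OF q_N])
      show "2 * (k * k) + 2 * (k * (m + 1)) = N * (2 * k)"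
        "2 * ((m + 1) * (m + 1)) + 2 * (k * (m + 1)) = N * (2 * (m + 1))"
        by (simp_all add: km[symmetric] algebra_simps)
    qed
    also have "2 * ((m + 1) * (m + 1)) = 1 + m + ((2 * m + 1 + 1) choose 2)"
      by (simp add: choose_two algebra_simps)
    also have "1 / (P (N - 1) * P r) * q ^ (1 + m + ((2 * m + 1 + 1) choose 2)) =
        const * (q ^ m * P (2 * m + 1))"
    proof -
      have "- (P r * P (2 * m + 1)) = P (N - 1) * q ^ ((2 * m + 1 + 1) choose 2)"
        using qpoch_reflect[OF q_N r(3)] unfolding r(2) by simp
      moreover have "P r \<noteq> 0" "P (N - 1) \<noteq> 0"
        using P_nonzero \<open>r < N\<close> N_pos by simp_all
      ultimately have "q ^ ((2 * m + 1 + 1) choose 2) = - (P r * P (2 * m + 1)) / P (N - 1)"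
        by (metis nonzero_mult_div_cancel_left)
      then show ?thesis
        unfolding power_add[of q "1 + m"] using \<open>P r \<noteq> 0\<close> by (simp add: power2_eq_square)
    qed
    finally show ?thesis
      unfolding top[symmetric] by (simp only: mult.assoc)
  qed
qed

text \<open>One Bailey step read backwards through k = N-1-n. Its denominators (x)_{n-m} have n - m
  < N and create no further pole, so the limit is taken termwise. The outer power of x is left out
  because the last step has none.\<close>

lemma lim_bailey_beta_sum:
  assumes "\<And>m. m < N \<Longrightarrow> (\<lambda>i. (1 - X i ^ N) * X i ^ ((N - 1 - m)\<^sup>2 + (N - 1 - m)) *
      bailey_beta p (N - 1 - m) (X i)) \<longlonglongrightarrow> const * F m * P m"
    and "m < N"
  shows "(\<lambda>i. (1 - X i ^ N) * bailey_beta (Suc p) (N - 1 - m) (X i)) \<longlonglongrightarrow>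
      (\<Sum>n=m..<N. const * F n * P n / P (n - m))"
proof -
  have "(\<lambda>i. \<Sum>n=m..<N. (1 - X i ^ N) * X i ^ ((N - 1 - n)\<^sup>2 + (N - 1 - n)) *
      bailey_beta p (N - 1 - n) (X i) / qpoch (X i) (X i) (n - m))
    \<longlonglongrightarrow> (\<Sum>n=m..<N. const * F n * P n / P (n - m))"
    by (intro tendsto_sum tendsto_divide assms(1) tendsto_qpoch lim_X P_nonzero) auto
  moreover have "(\<Sum>n=m..<N. (1 - x ^ N) * x ^ ((N - 1 - n)\<^sup>2 + (N - 1 - n)) *
      bailey_beta p (N - 1 - n) x / qpoch x x (n - m)) =
      (1 - x ^ N) * bailey_beta (Suc p) (N - 1 - m) x" for x
    unfolding bailey_beta.simps sum_distrib_left using assms(2)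
    by (intro sum.reindex_bij_witness[of _ "\<lambda>k. N - 1 - k" "\<lambda>n. N - 1 - n"])
      (auto simp: Suc_diff_le intro!: arg_cong2[of _ _ _ _ "(/)"] arg_cong[of _ _ "qpoch x x"])
  ultimately show ?thesis by simp
qed

text \<open>(q)_n / (q)_{n-m} is the Gaussian binomial times (q)_m, so each Bailey step turns into
  one \<open>peel\<close> in the limit.\<close>

lemma lim_bailey_beta:
  assumes "m < N"
  shows "(\<lambda>i. (1 - X i ^ N) * X i ^ ((N - 1 - m)\<^sup>2 + (N - 1 - m)) * bailey_beta p (N - 1 - m) (X i))
     \<longlonglongrightarrow> const * (peel q N ^^ p) top_weight m * P m"
  using assms
proof (induction p arbitrary: m)
  case 0
  then show ?case using lim_bailey_beta_0 by simp
next
  case (Suc p)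
  let ?F = "(peel q N ^^ p) top_weight" and ?k = "N - 1 - m"
  have "(\<lambda>i. X i ^ (?k\<^sup>2 + ?k) * ((1 - X i ^ N) * bailey_beta (Suc p) ?k (X i))) \<longlonglongrightarrow>
      q ^ (?k\<^sup>2 + ?k) * (\<Sum>n=m..<N. const * ?F n * P n / P (n - m))"
    using lim_bailey_beta_sum[OF Suc.IH Suc.prems] by (intro tendsto_mult tendsto_power lim_X)
  \<comment> \<open>The product m(m+1) is invariant under m -> -1-m, and ?k is congruent to -1-m
    modulo N.\<close>
  also have "q ^ (?k\<^sup>2 + ?k) = q ^ (m * (m + 1))"
  proof (rule root_of_unity_power_cong[OF q_N])
    have N: "N = ?k + 1 + m" using Suc.prems by simp
    show "?k\<^sup>2 + ?k + ?k * m = N * ?k" "m * (m + 1) + ?k * m = N * m"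
      by (subst (3) N, simp add: power2_eq_square algebra_simps)
        (subst (2) N, simp add: algebra_simps)
  qed
  also have "(\<Sum>n=m..<N. const * ?F n * P n / P (n - m)) =
      (\<Sum>n=m..<N. const * (qbinom q n m * ?F n) * P m)"
  proof (intro sum.cong refl)
    fix n assume "n \<in> {m..<N}"
    then have "P (n - m) \<noteq> 0" "P m \<noteq> 0" "m \<le> n"
      using P_nonzero by auto
    then show "const * ?F n * P n / P (n - m) = const * (qbinom q n m * ?F n) * P m"
      by (simp add: qbinom_eq_quotient)
  qed
  also have "\<dots> = (\<Sum>n<N. const * (qbinom q n m * ?F n) * P m)"
    by (rule sum.mono_neutral_left) (auto simp: qbinom_eq_0)
  also have "q ^ (m * (m + 1)) * \<dots> = const * (peel q N ^^ Suc p) top_weight m * P m"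
    by (simp add: peel_def sum_distrib_left sum_distrib_right mult_ac)
  finally show ?case
    by (simp only: mult_ac)
qed

text \<open>At m = 0 the ratio of Pochhammer symbols is 1, so the outermost Bailey sum becomes the
  plain sum over n_1.\<close>

lemma lim_bailey_beta_multisum:
  "(\<lambda>i. (1 - X i ^ N) * bailey_beta (Suc p) (N - 1) (X i)) \<longlonglongrightarrow> const * H (Suc p) q"
proof -
  have "(\<lambda>i. (1 - X i ^ N) * bailey_beta (Suc p) (N - 1 - 0) (X i)) \<longlonglongrightarrow>
      (\<Sum>n=0..<N. const * (peel q N ^^ p) top_weight n * P n / P (n - 0))"
    by (rule lim_bailey_beta_sum[OF lim_bailey_beta N_pos])
  also have "(\<Sum>n=0..<N. const * (peel q N ^^ p) top_weight n * P n / P (n - 0)) =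
      (\<Sum>n<N. const * (peel q N ^^ p) top_weight n)"
    using P_nonzero by (intro sum.cong) auto
  also have "\<dots> = const * H (Suc p) q"
    by (simp only: H_eq_sum_peel[OF q_N N_pos] sum_distrib_left)
  finally show ?thesis by simp
qed

text \<open>For n = N-1 the denominators in \<open>bailey_beta_eq\<close> are (x)_{N-1-k} (x)_{N+k},
  and only the second has a zero at q; \<open>lim_pole\<close> handles it.\<close>

lemma lim_bailey_beta_alpha:
  "(\<lambda>i. (1 - X i ^ N) * bailey_beta (Suc p) (N - 1) (X i)) \<longlonglongrightarrow>
   (\<Sum>k=0..N - 1. (- 1) ^ k * q ^ (((k + 1) choose 2) + p * (k\<^sup>2 + k)) * alpha q k) *
     ((1 - q) / (P (N - 1))\<^sup>2)"
proof -
  have "(\<lambda>i. \<Sum>k\<le>N - 1. X i ^ (Suc p * (k\<^sup>2 + k)) * ((1 - X i) * alpha (X i) k) /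
      qpoch (X i) (X i) (N - 1 - k) * ((1 - X i ^ N) / qpoch (X i) (X i) (N + k))) \<longlonglongrightarrow>
    (\<Sum>k\<le>N - 1. q ^ (Suc p * (k\<^sup>2 + k)) * ((1 - q) * alpha q k) / P (N - 1 - k) *
      (1 / (P (N - 1) * P k)))"
    using N_pos by (intro tendsto_intros tendsto_alpha lim_X lim_pole P_nonzero q_nonzero) auto
  also have "(\<lambda>i. \<Sum>k\<le>N - 1. X i ^ (Suc p * (k\<^sup>2 + k)) * ((1 - X i) * alpha (X i) k) /
      qpoch (X i) (X i) (N - 1 - k) * ((1 - X i ^ N) / qpoch (X i) (X i) (N + k))) =
    (\<lambda>i. (1 - X i ^ N) * bailey_beta (Suc p) (N - 1) (X i))"
  proof
    fix i
    have "N - 1 + k + 1 = N + k" for k using N_pos by simp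
    then show "(\<Sum>k\<le>N - 1. X i ^ (Suc p * (k\<^sup>2 + k)) * ((1 - X i) * alpha (X i) k) /
        qpoch (X i) (X i) (N - 1 - k) * ((1 - X i ^ N) / qpoch (X i) (X i) (N + k))) =
      (1 - X i ^ N) * bailey_beta (Suc p) (N - 1) (X i)"
      unfolding bailey_beta_eq[OF generic_X, symmetric] sum_distrib_left
      by (intro sum.cong refl) (simp del: mult_Suc power_Suc)
  qed
  also have "(\<Sum>k\<le>N - 1. q ^ (Suc p * (k\<^sup>2 + k)) * ((1 - q) * alpha q k) / P (N - 1 - k) *
      (1 / (P (N - 1) * P k))) =
    (\<Sum>k\<le>N - 1. (- 1) ^ k * q ^ (((k + 1) choose 2) + p * (k\<^sup>2 + k)) * alpha q k *
      ((1 - q) / (P (N - 1))\<^sup>2))"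
  proof (intro sum.cong refl)
    fix k assume "k \<in> {..N - 1}"
    then have k: "k < N" using N_pos by auto
    define c where "c = (k + 1) choose 2"
    have "2 * c = k\<^sup>2 + k"
      by (simp add: c_def choose_two power2_eq_square algebra_simps)
    \<comment> \<open>One of the p + 1 weights q^(k^2+k) is halved: one q^c goes into the
      reflection, which returns (-1)^k, and the other remains as the binomial power.\<close>
    then have "Suc p * (k\<^sup>2 + k) = c + (c + p * (k\<^sup>2 + k))" by simp
    then have e: "q ^ (Suc p * (k\<^sup>2 + k)) = q ^ c * q ^ (c + p * (k\<^sup>2 + k))"
      by (simp only: power_add)
    have nz: "P (N - 1 - k) \<noteq> 0" "P (N - 1) \<noteq> 0" "P k \<noteq> 0"
      using P_nonzero N_pos k by simp_all
    have "P (N - 1 - k) * P k * (- 1) ^ k = P (N - 1) * q ^ c"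
      using qpoch_reflect[OF q_N k] by (simp add: c_def)
    then have "q ^ c / (P (N - 1 - k) * (P (N - 1) * P k)) = (- 1) ^ k / (P (N - 1))\<^sup>2"
      using nz by (simp add: field_simps power2_eq_square)
    then have "q ^ c / (P (N - 1 - k) * (P (N - 1) * P k)) * (q ^ (c + p * (k\<^sup>2 + k)) * (1 - q) * alpha q k) =
      (- 1) ^ k / (P (N - 1))\<^sup>2 * (q ^ (c + p * (k\<^sup>2 + k)) * (1 - q) * alpha q k)"
      by simp
    then show "q ^ (Suc p * (k\<^sup>2 + k)) * ((1 - q) * alpha q k) / P (N - 1 - k) *
        (1 / (P (N - 1) * P k)) =
      (- 1) ^ k * q ^ (((k + 1) choose 2) + p * (k\<^sup>2 + k)) * alpha q k * ((1 - q) / (P (N - 1))\<^sup>2)"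
      unfolding e c_def[symmetric] by (simp add: mult_ac)
  qed
  finally show ?thesis
    unfolding sum_distrib_right[symmetric] atMost_atLeast0 .
qed

end

theorem theorem2p12:
  fixes p N :: nat and q :: complex
  assumes "1 \<le> p" and "0 < N" and "primitive_unity_root N q"
  shows "H p q = - inverse q * (1 - q) *
    (\<Sum>k=0..N - 1. (-1) ^ k * q ^ (((k + 1) choose 2) + (p - 1) * (k ^ 2 + k)) * alpha q k)"
proof -
  obtain X where "X \<longlonglongrightarrow> q" "\<And>i. not_unity_root (X i)"
    using primitive_unity_root_approx[OF assms(3)] by blast
  then interpret approximated_unity_root N q X
    using assms(3) by unfold_locales
  obtain r where p: "p = Suc r"
    using assms(1) by (cases p) auto
  have "P (N - 1) \<noteq> 0"
    by (rule P_nonzero) (use assms(2) in simp)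
  \<comment> \<open>Equating the two limits, (q)_{N-1}^2 cancels and division by -q gives the
    prefactor.\<close>
  then show ?thesis
    using LIMSEQ_unique[OF lim_bailey_beta_multisum lim_bailey_beta_alpha, of r] q_nonzero
    unfolding p diff_Suc_1 by (simp add: field_simps)
qed

end
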